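(* Let $n\ge1$. For polynomials $f,g\in\mathbb{Z}_2[\xi_1,\dots,\xi_n]$ and $k\ge0$, $$Jq^k(fg)=\sum_{i+j=k}Jq^i(f)\,Jq^j(g).$$
   Context: $\mathbb{Z}_2$ is the ring of dyadic ($2$-adic) integers. $\mathbb{Z}_2[\xi_1,\dots,\xi_n]$ is graded by $\deg\xi_i=1$. $Jq$ is the $\mathbb{Z}_2$-algebra endomorphism of $\mathbb{Z}_2[\xi_1,\dots,\xi_n]$ with $Jq(1)=1$, $Jq(\xi_i)=\xi_i+\xi_i^2$. For $k\ge0$, the dyadic Steenrod square $Jq^k$ is the $\mathbb{Z}_2$-linear map raising degree by $k$ obtained, on each degree $d$, by restricting $Jq$ to degree $d$ and projecting onto degree $d+k$. The sum is over $i,j\ge0$. *)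

theory Defs
  imports Main "HOL-Library.Poly_Mapping"
begin

section \<open>The dyadic integers\<close>

text \<open>
  The inverse limit of the rings of integers modulo \<open>2 ^ n\<close>: the \<open>n\<close>-th entry of a coherent
  sequence is the least nonnegative representative of the residue class modulo \<open>2 ^ n\<close>.
\<close>

typedef dyadic_int =
  "{x :: nat \<Rightarrow> int. \<forall>n. 0 \<le> x n \<and> x n < 2 ^ n \<and> x (Suc n) mod 2 ^ n = x n}"
  by (rule exI [where x = "\<lambda>_. 0"]) simp

setup_lifting type_definition_dyadic_int

lemma mod_power_Suc: "(a mod 2 ^ Suc n) mod 2 ^ n = a mod (2 ^ n :: int)"
  by (rule mod_mod_cancel) simp

instantiation dyadic_int :: comm_ring_1
begin

lift_definition zero_dyadic_int :: dyadic_int is "\<lambda>_. 0"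
  by simp

lift_definition one_dyadic_int :: dyadic_int is "\<lambda>n. 1 mod 2 ^ n"
  by (simp only: mod_power_Suc) simp

lift_definition plus_dyadic_int :: "dyadic_int \<Rightarrow> dyadic_int \<Rightarrow> dyadic_int"
  is "\<lambda>x y n. (x n + y n) mod 2 ^ n"
  by (simp only: mod_power_Suc) (simp, metis mod_add_eq)

lift_definition minus_dyadic_int :: "dyadic_int \<Rightarrow> dyadic_int \<Rightarrow> dyadic_int"
  is "\<lambda>x y n. (x n - y n) mod 2 ^ n"
  by (simp only: mod_power_Suc) (simp, metis mod_diff_eq)

lift_definition uminus_dyadic_int :: "dyadic_int \<Rightarrow> dyadic_int"
  is "\<lambda>x n. (- x n) mod 2 ^ n"
  by (simp only: mod_power_Suc) (simp, metis mod_minus_eq)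

lift_definition times_dyadic_int :: "dyadic_int \<Rightarrow> dyadic_int \<Rightarrow> dyadic_int"
  is "\<lambda>x y n. (x n * y n) mod 2 ^ n"
  by (simp only: mod_power_Suc) (simp, metis mod_mult_eq)

instance
proof
  fix a b c :: dyadic_int
  show "a + b + c = a + (b + c)"
    by transfer (simp add: fun_eq_iff mod_simps ac_simps)
  show "a + b = b + a"
    by transfer (simp add: fun_eq_iff ac_simps)
  show "0 + a = a"
    by transfer (simp add: fun_eq_iff)
  show "- a + a = 0"
    by transfer (simp add: fun_eq_iff mod_simps)
  show "a - b = a + - b"
    by transfer (simp add: fun_eq_iff mod_simps)
  show "a * b * c = a * (b * c)"
    by transfer (simp add: fun_eq_iff mod_simps ac_simps)
  show "a * b = b * a"
    by transfer (simp add: fun_eq_iff ac_simps)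
  show "1 * a = a"
  proof (transfer, rule ext)
    fix a :: "nat \<Rightarrow> int" and n
    assume "\<forall>n. 0 \<le> a n \<and> a n < 2 ^ n \<and> a (Suc n) mod 2 ^ n = a n"
    then have "a n mod 2 ^ n = a n" by simp
    then show "(1 mod 2 ^ n * a n) mod 2 ^ n = a n" by (simp only: mod_mult_left_eq mult_1)
  qed
  show "(a + b) * c = a * c + b * c"
    by transfer (simp add: fun_eq_iff mod_simps algebra_simps)
  show "(0::dyadic_int) \<noteq> 1"
  proof (transfer, rule notI)
    assume "(\<lambda>_. 0) = (\<lambda>n. 1 mod 2 ^ n :: int)"
    then have "(0::int) = 1 mod 2 ^ 1" by (rule fun_cong)
    then show False by simp
  qed
qed

end


section \<open>Polynomials\<close>

text \<open>
  Variables are indexed by a type \<open>'n\<close> (finite in the main results, with \<open>CARD('n)\<close> variables);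
  a polynomial maps exponent vectors to coefficients, with finite support, and the library's
  multiplication of \<^typ>\<open>'a \<Rightarrow>\<^sub>0 'b\<close> is convolution.
\<close>

type_synonym 'n dpoly = "('n \<Rightarrow>\<^sub>0 nat) \<Rightarrow>\<^sub>0 dyadic_int"

definition const :: "dyadic_int \<Rightarrow> 'n dpoly"
  where "const c = Poly_Mapping.single 0 c"

definition \<xi> :: "'n \<Rightarrow> 'n dpoly"
  where "\<xi> i = Poly_Mapping.single (Poly_Mapping.single i 1) 1"

definition mdeg :: "('n::finite \<Rightarrow>\<^sub>0 nat) \<Rightarrow> nat"
  where "mdeg m = (\<Sum>i\<in>UNIV. Poly_Mapping.lookup m i)"

lift_definition homog_part ::
    "nat \<Rightarrow> (('n::finite \<Rightarrow>\<^sub>0 nat) \<Rightarrow>\<^sub>0 'b::zero) \<Rightarrow> (('n \<Rightarrow>\<^sub>0 nat) \<Rightarrow>\<^sub>0 'b)"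
  is "\<lambda>d f m. if mdeg m = d then f m else 0"
  by (rule finite_subset [rotated]) auto

definition homogeneous :: "nat \<Rightarrow> 'n::finite dpoly \<Rightarrow> bool"
  where "homogeneous d f \<longleftrightarrow> (\<forall>m\<in>Poly_Mapping.keys f. mdeg m = d)"

definition linear_map :: "('n dpoly \<Rightarrow> 'n dpoly) \<Rightarrow> bool"
  where "linear_map F \<longleftrightarrow>
    (\<forall>f g. F (f + g) = F f + F g) \<and> (\<forall>c f. F (const c * f) = const c * F f)"

definition algebra_endomorphism :: "('n dpoly \<Rightarrow> 'n dpoly) \<Rightarrow> bool"
  where "algebra_endomorphism F \<longleftrightarrow>
    linear_map F \<and> F 1 = 1 \<and> (\<forall>f g. F (f * g) = F f * F g)"


section \<open>The operations\<close>

definition Jq :: "'n::finite dpoly \<Rightarrow> 'n dpoly"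
  where "Jq = (THE F. algebra_endomorphism F \<and> (\<forall>i. F (\<xi> i) = \<xi> i + (\<xi> i)\<^sup>2))"

text \<open>
  The sum ranges over the finitely many degrees in which \<open>f\<close> has a nonzero homogeneous part.
\<close>

definition Jq_sq :: "nat \<Rightarrow> 'n::finite dpoly \<Rightarrow> 'n dpoly"
  where "Jq_sq k f = (\<Sum>d \<in> mdeg ` Poly_Mapping.keys f. homog_part (d + k) (Jq (homog_part d f)))"


section \<open>Well-definedness\<close>

lemma lookup_homog_part:
  "Poly_Mapping.lookup (homog_part d f) m = (if mdeg m = d then Poly_Mapping.lookup f m else 0)"
  by transfer simp

lemma poly_mapping_sum_singles:
  "f = (\<Sum>m\<in>Poly_Mapping.keys f. Poly_Mapping.single m (Poly_Mapping.lookup f m))"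
  by (rule poly_mapping_eqI)
    (auto simp: lookup_sum lookup_single when_def in_keys_iff)

lemma const_add: "const (a + b) = const a + const b"
  by (simp add: const_def single_add)

lemma const_mult: "const (a * b) = const a * const b"
  by (simp add: const_def mult_single)

lemma const_1 [simp]: "const 1 = 1"
  by (simp add: const_def)

lemma const_0 [simp]: "const 0 = 0"
  by (simp add: const_def)

definition subst_monom :: "('n \<Rightarrow> 'n dpoly) \<Rightarrow> ('n::finite \<Rightarrow>\<^sub>0 nat) \<Rightarrow> 'n dpoly"
  where "subst_monom s m = (\<Prod>i\<in>UNIV. s i ^ Poly_Mapping.lookup m i)"

definition subst :: "('n \<Rightarrow> 'n dpoly) \<Rightarrow> 'n::finite dpoly \<Rightarrow> 'n dpoly"
  where "subst s f = (\<Sum>m\<in>Poly_Mapping.keys f. const (Poly_Mapping.lookup f m) * subst_monom s m)"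

lemma subst_monom_add: "subst_monom s (m + m') = subst_monom s m * subst_monom s m'"
  by (simp add: subst_monom_def lookup_add power_add prod.distrib)

lemma subst_monom_0 [simp]: "subst_monom s 0 = 1"
  by (simp add: subst_monom_def)

lemma subst_superset:
  assumes "finite A" "Poly_Mapping.keys f \<subseteq> A"
  shows "subst s f = (\<Sum>m\<in>A. const (Poly_Mapping.lookup f m) * subst_monom s m)"
  unfolding subst_def
  by (rule sum.mono_neutral_left) (use assms in \<open>auto simp: in_keys_iff\<close>)

lemma subst_add: "subst s (f + g) = subst s f + subst s g"
proof -
  let ?A = "Poly_Mapping.keys f \<union> Poly_Mapping.keys g"
  have "Poly_Mapping.keys (f + g) \<subseteq> ?A" by (rule keys_add)
  then show ?thesis
    by (simp add: subst_superset [of ?A] lookup_add const_add distrib_right sum.distrib)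
qed

lemma subst_0 [simp]: "subst s 0 = 0"
  by (simp add: subst_def)

lemma subst_sum: "subst s (sum h A) = (\<Sum>a\<in>A. subst s (h a))"
  by (induction A rule: infinite_finite_induct) (simp_all add: subst_add)

lemma subst_single: "subst s (Poly_Mapping.single m c) = const c * subst_monom s m"
  by (subst subst_superset [of "{m}"]) auto

lemma subst_mult: "subst s (f * g) = subst s f * subst s g"
proof -
  have "f * g = (\<Sum>m\<in>Poly_Mapping.keys f. \<Sum>m'\<in>Poly_Mapping.keys g.
      Poly_Mapping.single (m + m') (Poly_Mapping.lookup f m * Poly_Mapping.lookup g m'))"
    by (subst poly_mapping_sum_singles [of f], subst poly_mapping_sum_singles [of g])
      (simp add: sum_product mult_single)
  then have "subst s (f * g) = (\<Sum>m\<in>Poly_Mapping.keys f. \<Sum>m'\<in>Poly_Mapping.keys g.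
      (const (Poly_Mapping.lookup f m) * subst_monom s m) * (const (Poly_Mapping.lookup g m') * subst_monom s m'))"
    by (simp add: subst_sum subst_single const_mult subst_monom_add ac_simps)
  then show ?thesis
    by (simp add: subst_def sum_product)
qed

lemma subst_const: "subst s (const c) = const c"
  unfolding const_def [of c] by (subst subst_single) (simp add: const_def)

lemma subst_\<xi>: "subst s (\<xi> i) = s i"
proof -
  have "subst_monom s (Poly_Mapping.single i 1) = (\<Prod>j\<in>UNIV. if j = i then s i else 1)"
    unfolding subst_monom_def
    by (rule prod.cong) (auto simp: lookup_single when_def)
  then show ?thesis
    by (simp add: \<xi>_def subst_single)
qed

lemma algebra_endomorphism_subst: "algebra_endomorphism (subst s)"
  unfolding algebra_endomorphism_def linear_map_def
  using subst_const [of s 1] by (auto simp: subst_add subst_mult subst_const)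

lemma subst_monom_\<xi>: "subst_monom \<xi> m = Poly_Mapping.single m 1"
proof -
  have pow: "\<xi> i ^ k = Poly_Mapping.single (Poly_Mapping.single i k) 1" for i :: 'a and k
    by (induction k) (simp_all add: \<xi>_def mult_single flip: single_add)
  have "(\<Prod>i\<in>A. \<xi> i ^ Poly_Mapping.lookup m i) =
      Poly_Mapping.single (\<Sum>i\<in>A. Poly_Mapping.single i (Poly_Mapping.lookup m i)) 1" for A
    by (induction A rule: infinite_finite_induct) (simp_all add: pow mult_single)
  moreover have "(\<Sum>i\<in>UNIV. Poly_Mapping.single i (Poly_Mapping.lookup m i)) = m"
    by (rule poly_mapping_eqI) (simp add: lookup_sum lookup_single when_def)
  ultimately show ?thesis
    by (simp add: subst_monom_def)
qed

lemma algebra_endomorphism_eq_subst: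
  assumes "algebra_endomorphism F"
  shows "F f = subst (\<lambda>i. F (\<xi> i)) f"
proof -
  have add: "F (g + h) = F g + F h" and scale: "F (const c * g) = const c * F g"
    and one: "F 1 = 1" and mult: "F (g * h) = F g * F h" for c g h
    using assms unfolding algebra_endomorphism_def linear_map_def by blast+
  have zero: "F 0 = 0"
    using add [of 0 0] by simp
  have sum: "F (sum h A) = (\<Sum>a\<in>A. F (h a))" for h and A :: "('a \<Rightarrow>\<^sub>0 nat) set"
    by (induction A rule: infinite_finite_induct) (simp_all add: add zero)
  have pow: "F (g ^ k) = F g ^ k" for g k
    by (induction k) (simp_all add: one mult)
  have prod: "F (prod h A) = (\<Prod>a\<in>A. F (h a))" for h and A :: "'a set"
    by (induction A rule: infinite_finite_induct) (simp_all add: one mult)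
  have monom: "F (subst_monom \<xi> m) = subst_monom (\<lambda>i. F (\<xi> i)) m" for m
    by (simp add: subst_monom_def prod pow)
  have "f = subst \<xi> f"
    by (subst poly_mapping_sum_singles)
      (simp add: subst_def subst_monom_\<xi> const_def mult_single)
  then have "F f = F (subst \<xi> f)"
    by simp
  also have "\<dots> = subst (\<lambda>i. F (\<xi> i)) f"
    by (simp add: subst_def sum scale monom)
  finally show ?thesis .
qed

lemma Jq_ex1:
  "\<exists>!F :: 'n::finite dpoly \<Rightarrow> 'n dpoly.
    algebra_endomorphism F \<and> (\<forall>i. F (\<xi> i) = \<xi> i + (\<xi> i)\<^sup>2)"
proof (rule ex1I)
  show "algebra_endomorphism (subst (\<lambda>i. \<xi> i + (\<xi> i)\<^sup>2)) \<and>
      (\<forall>i. subst (\<lambda>i. \<xi> i + (\<xi> i)\<^sup>2) (\<xi> i) = \<xi> i + (\<xi> i)\<^sup>2)"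
    by (simp add: algebra_endomorphism_subst subst_\<xi>)
next
  fix F :: "'n dpoly \<Rightarrow> 'n dpoly"
  assume F: "algebra_endomorphism F \<and> (\<forall>i. F (\<xi> i) = \<xi> i + (\<xi> i)\<^sup>2)"
  then show "F = subst (\<lambda>i. \<xi> i + (\<xi> i)\<^sup>2)"
    using algebra_endomorphism_eq_subst [of F] by (simp add: fun_eq_iff)
qed

lemma Jq_algebra_endomorphism: "algebra_endomorphism Jq"
  and Jq_\<xi>: "Jq (\<xi> i) = \<xi> i + (\<xi> i)\<^sup>2"
  unfolding Jq_def using theI' [OF Jq_ex1] by blast+

lemma homog_part_add: "homog_part d (f + g) = homog_part d f + homog_part d g"
  by (rule poly_mapping_eqI) (simp add: lookup_homog_part lookup_add)

lemma lookup_const_mult: "Poly_Mapping.lookup (const c * f) m = c * Poly_Mapping.lookup f m"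
proof -
  have "Poly_Mapping.lookup (const c * f) m = Poly_Mapping.lookup (Poly_Mapping.map ((*) c) f) m"
    by (simp add: const_def mult_map_scale_conv_mult)
  then show ?thesis
    by (simp add: Poly_Mapping.map.rep_eq when_def)
qed

lemma homog_part_scale: "homog_part d (const c * f) = const c * homog_part d f"
  by (rule poly_mapping_eqI) (simp add: lookup_homog_part lookup_const_mult)

lemma homog_part_0 [simp]: "homog_part d 0 = 0"
  by (rule poly_mapping_eqI) (simp add: lookup_homog_part)

lemma Jq_sq_superset:
  assumes "finite D" "mdeg ` Poly_Mapping.keys f \<subseteq> D"
  shows "Jq_sq k f = (\<Sum>d\<in>D. homog_part (d + k) (Jq (homog_part d f)))"
proof -
  have "homog_part d f = 0" if "d \<notin> mdeg ` Poly_Mapping.keys f" for d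
    by (rule poly_mapping_eqI) (use that in \<open>auto simp: lookup_homog_part in_keys_iff\<close>)
  moreover have "Jq 0 = (0 :: 'a dpoly)"
    using Jq_algebra_endomorphism algebra_endomorphism_eq_subst subst_0 by metis
  ultimately show ?thesis
    unfolding Jq_sq_def by (intro sum.mono_neutral_left) (use assms in auto)
qed

lemma linear_map_Jq_sq: "linear_map (Jq_sq k)"
  unfolding linear_map_def
proof (intro conjI allI)
  have add: "Jq (g + h) = Jq g + Jq h" and scale: "Jq (const c * g) = const c * Jq g"
    for c and g h :: "'a dpoly"
    using Jq_algebra_endomorphism unfolding algebra_endomorphism_def linear_map_def by blast+
  show "Jq_sq k (f + g) = Jq_sq k f + Jq_sq k g" for f g :: "'a dpoly"
  proof -
    let ?D = "mdeg ` (Poly_Mapping.keys f \<union> Poly_Mapping.keys g)"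
    have "mdeg ` Poly_Mapping.keys (f + g) \<subseteq> ?D"
      using keys_add [of f g] by (rule image_mono)
    moreover have "finite ?D" "mdeg ` Poly_Mapping.keys f \<subseteq> ?D" "mdeg ` Poly_Mapping.keys g \<subseteq> ?D"
      by auto
    ultimately show ?thesis
      by (simp only: Jq_sq_superset [of ?D] homog_part_add add sum.distrib)
  qed
  show "Jq_sq k (const c * f) = const c * Jq_sq k f" for c and f :: "'a dpoly"
  proof -
    have "mdeg ` Poly_Mapping.keys (const c * f) \<subseteq> mdeg ` Poly_Mapping.keys f"
      by (intro image_mono) (auto simp: in_keys_iff lookup_const_mult)
    then show ?thesis
      by (simp add: Jq_sq_superset [of "mdeg ` Poly_Mapping.keys f"] homog_part_scale scale sum_distrib_left)
  qed
qed

lemma Jq_sq_homogeneous: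
  assumes "homogeneous d f"
  shows "Jq_sq k f = homog_part (d + k) (Jq f)"
proof -
  have "homog_part d f = f"
    by (rule poly_mapping_eqI)
      (use assms in \<open>auto simp: homogeneous_def lookup_homog_part in_keys_iff\<close>)
  then show ?thesis
    using Jq_sq_superset [of "{d}" f] assms by (auto simp: homogeneous_def)
qed

end

theory Submission
  imports Defs
begin

text \<open>
  Both sides are biadditive in \<open>f\<close> and \<open>g\<close>, so \<open>f\<close> and \<open>g\<close> may be taken to be terms, of degrees
  \<open>d\<close> and \<open>e\<close>. Then \<open>Jq\<^sup>k (f g)\<close> is the degree \<open>d + e + k\<close> part of \<open>Jq f \<cdot> Jq g\<close>, and since \<open>Jq\<close> never
  lowers degrees, only the parts of \<open>Jq f\<close> and \<open>Jq g\<close> of degrees \<open>d + i\<close> and \<open>e + j\<close> with \<open>i + j = k\<close>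
  contribute to it.
\<close>

lemma finite_add_eq_nat: "finite {(i, j). i + j = (k::nat)}"
  by (rule finite_subset [of _ "{..k} \<times> {..k}"]) auto

text \<open>A finitely supported function is a finite sum of singles, so additivity propagates
  agreement from these. Cancellation in the codomain yields the value \<open>0\<close> at
  \<open>0\<close>, needed for empty sums.\<close>

lemma additive_eqI:
  fixes F G :: "('a \<Rightarrow>\<^sub>0 'b::comm_monoid_add) \<Rightarrow> 'c::ab_group_add"
  assumes F: "\<And>f g. F (f + g) = F f + F g" and G: "\<And>f g. G (f + g) = G f + G g"
    and single: "\<And>m c. F (Poly_Mapping.single m c) = G (Poly_Mapping.single m c)"
  shows "F f = G f"
proof -
  have zero: "F 0 = 0" "G 0 = 0"
    using F [of 0 0] G [of 0 0] by simp_all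
  have sum: "F (sum h A) = (\<Sum>a\<in>A. F (h a))" "G (sum h A) = (\<Sum>a\<in>A. G (h a))"
    for h and A :: "'a set"
    by (induction A rule: infinite_finite_induct) (simp_all add: F G zero)
  show ?thesis
    by (subst (1 2) poly_mapping_sum_singles [of f]) (simp add: sum single)
qed

text \<open>Apply \<open>additive_eqI\<close> in the first argument, then in the second with the
  first fixed at a single. Both product formulas below are reduced to terms this way.\<close>

lemma biadditive_eqI:
  fixes B C :: "('a \<Rightarrow>\<^sub>0 'b::comm_monoid_add) \<Rightarrow> ('d \<Rightarrow>\<^sub>0 'e::comm_monoid_add) \<Rightarrow> 'c::ab_group_add"
  assumes "\<And>f f' g. B (f + f') g = B f g + B f' g" "\<And>f g g'. B f (g + g') = B f g + B f g'"
    and "\<And>f f' g. C (f + f') g = C f g + C f' g" "\<And>f g g'. C f (g + g') = C f g + C f g'"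
    and "\<And>m a m' b. B (Poly_Mapping.single m a) (Poly_Mapping.single m' b) =
      C (Poly_Mapping.single m a) (Poly_Mapping.single m' b)"
  shows "B f g = C f g"
  by (rule additive_eqI [where F = "\<lambda>f. B f g" and G = "\<lambda>f. C f g"], fact, fact,
      rule additive_eqI [where F = "B _" and G = "C _"], fact, fact, fact)

lemma mdeg_add: "mdeg (m + m') = mdeg m + mdeg m'"
  by (simp add: mdeg_def lookup_add sum.distrib)

lemma mdeg_single [simp]: "mdeg (Poly_Mapping.single i n) = n"
  by (simp add: mdeg_def lookup_single when_def)

lemma homog_part_single:
  "homog_part d (Poly_Mapping.single m c) = (if mdeg m = d then Poly_Mapping.single m c else 0)"
  by (rule poly_mapping_eqI) (auto simp: lookup_homog_part lookup_single when_def)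

text \<open>For two terms only the pair of their own degrees can contribute, and it lies in the
  index set exactly when the degree of their product is \<open>e\<close>.\<close>

lemma homog_part_mult:
  fixes f g :: "'n::finite dpoly"
  shows "homog_part e (f * g) = (\<Sum>(i, j) \<in> {(i, j). i + j = e}. homog_part i f * homog_part j g)"
proof (rule biadditive_eqI [where B = "\<lambda>f g. homog_part e (f * g)"])
  fix m m' :: "'n \<Rightarrow>\<^sub>0 nat" and a b :: dyadic_int
  let ?f = "Poly_Mapping.single m a" and ?g = "Poly_Mapping.single m' b"
  \<comment> \<open>Phrasing the condition as equality with one pair lets the sum over pairs
    collapse to one summand.\<close>
  have "homog_part i ?f * homog_part j ?g = (if (i, j) = (mdeg m, mdeg m') then ?f * ?g else 0)"
    for i j
    by (simp add: homog_part_single)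
  then have "(\<Sum>(i, j) \<in> {(i, j). i + j = e}. homog_part i ?f * homog_part j ?g) =
      (\<Sum>p \<in> {(i, j). i + j = e}. if p = (mdeg m, mdeg m') then ?f * ?g else 0)"
    by (intro sum.cong refl) (simp only: split_paired_all prod.case)
  also have "\<dots> = homog_part e (?f * ?g)"
    by (simp add: finite_add_eq_nat mult_single homog_part_single mdeg_add)
  finally show "homog_part e (?f * ?g) =
      (\<Sum>(i, j) \<in> {(i, j). i + j = e}. homog_part i ?f * homog_part j ?g)" ..
qed (simp_all add: homog_part_add distrib_left distrib_right sum.distrib case_prod_unfold)

text \<open>A lower bound rather than the exact lowest degree: \<open>0\<close> satisfies it for
  every \<open>d\<close>, which covers terms with zero coefficient.\<close>

definition min_degree_ge :: "nat \<Rightarrow> 'n::finite dpoly \<Rightarrow> bool"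
  where "min_degree_ge d f \<longleftrightarrow> (\<forall>i<d. homog_part i f = 0)"

lemma min_degree_ge_0 [simp]: "min_degree_ge 0 f"
  by (simp add: min_degree_ge_def)

lemma min_degree_ge_mult:
  assumes "min_degree_ge d f" "min_degree_ge e g"
  shows "min_degree_ge (d + e) (f * g)"
  unfolding min_degree_ge_def
proof (intro allI impI)
  fix k assume "k < d + e"
  have "homog_part i f * homog_part j g = 0" if "i + j = k" for i j
  proof -
    \<comment> \<open>Otherwise \<open>i + j\<close> would reach \<open>d + e\<close>; so one factor
      vanishes.\<close>
    have "i < d \<or> j < e"
      using that \<open>k < d + e\<close> by linarith
    then show ?thesis
      using assms by (auto simp: min_degree_ge_def)
  qed
  then show "homog_part k (f * g) = 0"
    unfolding homog_part_mult by (intro sum.neutral) auto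
qed

lemma min_degree_ge_power:
  assumes "min_degree_ge d f"
  shows "min_degree_ge (k * d) (f ^ k)"
  using assms by (induction k) (simp_all add: min_degree_ge_mult)

lemma min_degree_ge_prod:
  assumes "\<And>a. a \<in> A \<Longrightarrow> min_degree_ge (d a) (h a)"
  shows "min_degree_ge (sum d A) (prod h A)"
  using assms by (induction A rule: infinite_finite_induct) (simp_all add: min_degree_ge_mult)

text \<open>This is the precise sense in which \<open>Jq\<close> never lowers degrees: each
  \<open>\<xi> i + (\<xi> i)\<^sup>2\<close> starts in degree 1, and the bounds add up over the
  factors of a monomial.\<close>

lemma min_degree_ge_Jq_single: "min_degree_ge (mdeg m) (Jq (Poly_Mapping.single m c))"
proof -
  have "min_degree_ge 1 (Jq (\<xi> i))" for i :: 'a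
    unfolding min_degree_ge_def Jq_\<xi> unfolding \<xi>_def
    by (simp add: homog_part_add power2_eq_square mult_single homog_part_single mdeg_add)
  then have "min_degree_ge (mdeg m) (subst_monom (\<lambda>i. Jq (\<xi> i)) m)"
    unfolding mdeg_def subst_monom_def
    by (intro min_degree_ge_prod) (metis min_degree_ge_power mult.right_neutral)
  then have "min_degree_ge (mdeg m) (const c * subst_monom (\<lambda>i. Jq (\<xi> i)) m)"
    by (simp add: min_degree_ge_def homog_part_scale)
  then show ?thesis
    using algebra_endomorphism_eq_subst [OF Jq_algebra_endomorphism]
    by (metis subst_single)
qed

text \<open>Of the pairs with sum \<open>d + e + k\<close>, those with a component below its bound
  give zero; the rest are the pairs with sum \<open>k\<close> shifted by
  \<open>(d, e)\<close>.\<close>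

lemma homog_part_mult_min_degree_ge:
  assumes "min_degree_ge d f" "min_degree_ge e g"
  shows "homog_part (d + e + k) (f * g) =
    (\<Sum>(i, j) \<in> {(i, j). i + j = k}. homog_part (d + i) f * homog_part (e + j) g)"
proof -
  let ?shift = "\<lambda>(i, j). (d + i, e + j)"
  have "homog_part (d + e + k) (f * g) =
      (\<Sum>(i, j) \<in> ?shift ` {(i, j). i + j = k}. homog_part i f * homog_part j g)"
    unfolding homog_part_mult
  proof (rule sum.mono_neutral_right)
    have zero: "homog_part i f * homog_part j g = 0"
      if "i + j = d + e + k" "(i, j) \<notin> ?shift ` {(i, j). i + j = k}" for i j
    proof (cases "i < d \<or> j < e")
      case True
      then show ?thesis
        using assms by (auto simp: min_degree_ge_def)
    next
      case False
      \<comment> \<open>Here \<open>d \<le> i\<close> and \<open>e \<le> j\<close>, so the truncated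
        subtractions are exact.\<close>
      then have "(i, j) = ?shift (i - d, j - e)" "(i - d) + (j - e) = k"
        using that(1) by auto
      then show ?thesis
        using that(2) by blast
    qed
    show "\<forall>p \<in> {(i, j). i + j = d + e + k} - ?shift ` {(i, j). i + j = k}.
        (case p of (i, j) \<Rightarrow> homog_part i f * homog_part j g) = 0"
    proof
      fix p assume "p \<in> {(i, j). i + j = d + e + k} - ?shift ` {(i, j). i + j = k}"
      then show "(case p of (i, j) \<Rightarrow> homog_part i f * homog_part j g) = 0"
        using zero [of "fst p" "snd p"] by (simp add: case_prod_unfold)
    qed
  qed (auto simp: finite_add_eq_nat)
  also have "\<dots> = (\<Sum>(i, j) \<in> {(i, j). i + j = k}. homog_part (d + i) f * homog_part (e + j) g)"
    by (subst sum.reindex) (auto simp: inj_on_def case_prod_unfold)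
  finally show ?thesis .
qed

theorem proposition2p8:
  fixes f g :: "'n::finite dpoly" and k :: nat
  shows "Jq_sq k (f * g) = (\<Sum>(i, j) \<in> {(i, j). i + j = k}. Jq_sq i f * Jq_sq j g)"
proof -
  have add: "Jq_sq k (f + g) = Jq_sq k f + Jq_sq k g" for k and f g :: "'n dpoly"
    using linear_map_Jq_sq unfolding linear_map_def by blast
  show ?thesis
  proof (rule biadditive_eqI [where B = "\<lambda>f g. Jq_sq k (f * g)"])
    fix m m' :: "'n \<Rightarrow>\<^sub>0 nat" and a b :: dyadic_int
    let ?f = "Poly_Mapping.single m a" and ?g = "Poly_Mapping.single m' b"
    \<comment> \<open>A single is homogeneous of degree \<open>mdeg m\<close> even for
      \<open>c = 0\<close>, when it has no keys.\<close>
    have single: "Jq_sq k (Poly_Mapping.single m c) = homog_part (mdeg m + k) (Jq (Poly_Mapping.single m c))"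
      for k c and m :: "'n \<Rightarrow>\<^sub>0 nat"
      by (rule Jq_sq_homogeneous) (simp add: homogeneous_def)
    have "Jq_sq k (?f * ?g) = homog_part (mdeg m + mdeg m' + k) (Jq (?f * ?g))"
      by (simp add: mult_single single mdeg_add)
    also have "Jq (?f * ?g) = Jq ?f * Jq ?g"
      using Jq_algebra_endomorphism unfolding algebra_endomorphism_def by blast
    finally show "Jq_sq k (?f * ?g) = (\<Sum>(i, j) \<in> {(i, j). i + j = k}. Jq_sq i ?f * Jq_sq j ?g)"
      by (simp add: homog_part_mult_min_degree_ge min_degree_ge_Jq_single single)
  qed (simp_all add: add distrib_left distrib_right sum.distrib case_prod_unfold)
qed

end
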